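(* Let $\Phi:\mathbb{R}^N\to(-\infty,+\infty]$ be a proper and lower semicontinuous function which is bounded from below. Let $\mathcal{A}$ be a generic algorithm (a set-valued map on $\mathbb{R}^N$) which generates a bounded sequence $\{z^{(k)}\}$ by $z^{(0)}\in\mathbb{R}^N$, $z^{(k+1)}\in\mathcal{A}(z^{(k)})$, $k=0,1,\dots$. Assume that there exist positive constants $\rho_1,\rho_2,\rho_3$ and a non-negative sequence $\{\zeta_k\}_{k\in\mathbb{N}}$ such that: (B1) $\rho_1\|z^{(k)}-z^{(k+1)}\|^2\le\rho_2\zeta_k^2\le\Phi(z^{(k)})-\Phi(z^{(k+1)})$ for all $k=0,1,\dots$; (B2) there are $w^{(k)}\in\partial\Phi(z^{(k)})$ such that $\|w^{(k+1)}\|\le\rho_3\zeta_k$ for all $k=0,1,\dots$; (B3) $\Phi$ is a KL function; (B4) if a subsequence $\{z^{(k_n)}\}$ converges to $\bar z$, then $\Phi(z^{(k_n)})\to\Phi(\bar z)$ as $n\to\infty$. Suppose moreover that the function $\xi$ in the KL property of $\Phi$ has the form $\xi(a)=Ca^{1-\omega}$ for some $C>0$ and $\omega\in[0,1)$. Let $\bar z$ denote the limit of $\{z^{(k)}\}$ (which exists under these conditions). Then: (i) If $\omega=0$, then $\{z^{(k)}\}$ converges after a finite number of steps. (ii) If $\omega\in(0,1/2]$, then there exist $\omega_1>0$ and $\omega_2\in[0,1)$ such that $\|z^{(k)}-\bar z\|\le\omega_1\omega_2^k$ for all $k\ge1$. (iii) If $\omega\in(1/2,1)$, then there exists $\omega_1>0$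 such that $\|z^{(k)}-\bar z\|\le\omega_1k^{-(1-\omega)/(2\omega-1)}$ for all $k\ge1$.
   Context: For a proper lower semicontinuous $g$ and $x\in\operatorname{dom}g$, the Fréchet subdifferential $\hat\partial g(x)$ is the set of $v$ with $\liminf_{y\ne x,y\to x}\frac{1}{\|y-x\|}(g(y)-g(x)-\langle v,y-x\rangle)\ge0$ ($\hat\partial g(x)=\emptyset$ if $x\notin\operatorname{dom}g$), and the limiting subdifferential $\partial g(x)$ is the set of $v$ for which there exist $x^{(k)}\to x$ with $g(x^{(k)})\to g(x)$ and $v^{(k)}\in\hat\partial g(x^{(k)})$ with $v^{(k)}\to v$. KL property: a function $\phi$ has the KL property at $\bar x\in\operatorname{dom}\partial\phi$ if there exist $\eta\in(0,+\infty]$, a neighborhood $U$ of $\bar x$ and a concave function $\xi:[0,\eta)\to\mathbb{R}_+$ that is continuously differentiable on $(0,\eta)$, continuous at $0$, with $\xi(0)=0$ and $\xi'(t)>0$ for all $t\in(0,\eta)$, such that for all $x\in U$ with $\phi(\bar x)<\phi(x)<\phi(\bar x)+\eta$ one has $\xi'(\phi(x)-\phi(\bar x))\operatorname{dist}(0,\partial\phi(x))\ge1$, where $\operatorname{dist}(0,\partial\phi(x))=\min\{\|y\|:y\in\partial\phi(x)\}$ (equal to $+\infty$ if $\partial\phi(x)=\emptyset$). $\phi$ is a KL function if it has the KL property at each point of $\operatorname{dom}\partial\phi$. *)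

theory Defs
  imports "HOL-Analysis.Analysis"
begin

text \<open>Functions into \<open>(-\<infinity>, +\<infinity>]\<close> are modelled as functions into \<^typ>\<open>ereal\<close>;
  \<open>proper_fun\<close> excludes the value \<open>-\<infinity>\<close>.\<close>

definition dom_fun :: "('a \<Rightarrow> ereal) \<Rightarrow> 'a set" where
  "dom_fun g = {x. g x < \<infinity>}"

definition proper_fun :: "('a \<Rightarrow> ereal) \<Rightarrow> bool" where
  "proper_fun g \<longleftrightarrow> (\<forall>x. g x \<noteq> -\<infinity>) \<and> dom_fun g \<noteq> {}"

definition lower_semicontinuous :: "('a::topological_space \<Rightarrow> ereal) \<Rightarrow> bool" where
  "lower_semicontinuous g \<longleftrightarrow> (\<forall>x. g x \<le> Liminf (at x) g)"

definition frechet_subdiff :: "('a::real_inner \<Rightarrow> ereal) \<Rightarrow> 'a \<Rightarrow> 'a set" where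
  "frechet_subdiff g x =
     (if x \<in> dom_fun g
      then {v. Liminf (at x)
                 (\<lambda>y. (g y - g x - ereal (v \<bullet> (y - x))) / ereal (norm (y - x))) \<ge> 0}
      else {})"

text \<open>The restriction to the domain matters: otherwise points with \<open>g x = \<infinity>\<close> could be reached
  along sequences with finite \<open>g (x k) \<longlonglongrightarrow> \<infinity>\<close>.\<close>

definition limiting_subdiff :: "('a::real_inner \<Rightarrow> ereal) \<Rightarrow> 'a \<Rightarrow> 'a set" where
  "limiting_subdiff g x =
     (if x \<in> dom_fun g
      then {v. \<exists>xs vs. xs \<longlonglongrightarrow> x \<and> (\<lambda>k. g (xs k)) \<longlonglongrightarrow> g x \<and>
                       (\<forall>k. vs k \<in> frechet_subdiff g (xs k)) \<and> vs \<longlonglongrightarrow> v}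
      else {})"

definition dom_subdiff :: "('a::real_inner \<Rightarrow> ereal) \<Rightarrow> 'a set" where
  "dom_subdiff g = {x. limiting_subdiff g x \<noteq> {}}"

text \<open>\<open>dist(0, S)\<close> with value \<open>\<infinity>\<close> on the empty set, unlike \<^const>\<open>infdist\<close>.
  For closed \<open>S\<close> in finite dimension, such as a limiting subdifferential, the infimum is a
  minimum.\<close>

definition dist_zero :: "'a::real_normed_vector set \<Rightarrow> ereal" where
  "dist_zero S = (INF y\<in>S. ereal (norm y))"

definition desingularizing :: "ereal \<Rightarrow> (real \<Rightarrow> real) \<Rightarrow> bool" where
  "desingularizing \<eta> \<xi> \<longleftrightarrow>
     (let I = {t. 0 \<le> t \<and> ereal t < \<eta>}; J = {t. 0 < t \<and> ereal t < \<eta>} in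
       0 < \<eta> \<and>
       (\<forall>t\<in>I. 0 \<le> \<xi> t) \<and>
       concave_on I \<xi> \<and>
       (\<forall>t\<in>J. \<xi> differentiable (at t)) \<and> continuous_on J (deriv \<xi>) \<and>
       continuous (at 0 within I) \<xi> \<and>
       \<xi> 0 = 0 \<and>
       (\<forall>t\<in>J. deriv \<xi> t > 0))"

definition KL_property_with ::
    "('a::real_inner \<Rightarrow> ereal) \<Rightarrow> 'a \<Rightarrow> (real \<Rightarrow> real) \<Rightarrow> bool" where
  "KL_property_with \<phi> xbar \<xi> \<longleftrightarrow>
     xbar \<in> dom_subdiff \<phi> \<and>
     (\<exists>\<eta> U. desingularizing \<eta> \<xi> \<and> open U \<and> xbar \<in> U \<and>
        (\<forall>x\<in>U. \<phi> xbar < \<phi> x \<and> \<phi> x < \<phi> xbar + \<eta> \<longrightarrow>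
           ereal (deriv \<xi> (real_of_ereal (\<phi> x - \<phi> xbar))) * dist_zero (limiting_subdiff \<phi> x) \<ge> 1))"

definition KL_property :: "('a::real_inner \<Rightarrow> ereal) \<Rightarrow> 'a \<Rightarrow> bool" where
  "KL_property \<phi> xbar \<longleftrightarrow> (\<exists>\<xi>. KL_property_with \<phi> xbar \<xi>)"

definition KL_function :: "('a::real_inner \<Rightarrow> ereal) \<Rightarrow> bool" where
  "KL_function \<phi> \<longleftrightarrow> (\<forall>x\<in>dom_subdiff \<phi>. KL_property \<phi> x)"

end

theory Submission
  imports Defs
begin

text \<open>Write \<open>r k = \<Phi> (z k) - \<Phi> zbar\<close> for a cluster point \<open>zbar\<close>, which is critical because limiting
  subgradients are closed under limits. Near \<open>zbar\<close> the KL inequality and (B2) give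
  \<open>r (k+1) powr \<omega> \<le> c * \<zeta> k\<close>, and concavity of \<open>\<xi>\<close> turns this into
  \<open>2 * \<zeta> (k+1) + E * r (k+2) powr (1-\<omega>) \<le> \<zeta> k + E * r (k+1) powr (1-\<omega>)\<close>. Hence a multiple of
  \<open>\<zeta> k + E * r (k+1) powr (1-\<omega>)\<close> is a potential that drops by at least the length of each step;
  this traps the sequence near \<open>zbar\<close> and bounds the distance to the limit.
  Squaring the KL estimate and using (B1) yields \<open>r (k+1) powr (2*\<omega>) \<le> B * (r k - r (k+1))\<close>, which
  determines the rate of \<open>r\<close> and thereby that of the potential.\<close>

section \<open>Limits of limiting subgradients\<close>

text \<open>A late enough index of the defining sequences does. This is the selection step of the
  diagonal argument below, where point, vector and function value must all be approximated at
  once.\<close>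

lemma limiting_subdiff_approx:
  assumes v: "v \<in> limiting_subdiff g x" and a: "g x = ereal a" and e: "0 < e"
  shows "\<exists>y u. u \<in> frechet_subdiff g y \<and> dist y x < e \<and> dist u v < e \<and>
           ereal (a - e) < g y \<and> g y < ereal (a + e)"
proof -
  from v obtain xs vs where xs: "xs \<longlonglongrightarrow> x" and g: "(\<lambda>k. g (xs k)) \<longlonglongrightarrow> g x"
    and fr: "\<And>k. vs k \<in> frechet_subdiff g (xs k)" and vs: "vs \<longlonglongrightarrow> v"
    by (auto simp: limiting_subdiff_def split: if_splits)
  have "\<forall>\<^sub>F k in sequentially. ereal (a - e) < g (xs k)"
    using order_tendstoD(1)[OF g, of "ereal (a - e)"] a e by simp
  moreover have "\<forall>\<^sub>F k in sequentially. g (xs k) < ereal (a + e)"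
    using order_tendstoD(2)[OF g, of "ereal (a + e)"] a e by simp
  ultimately have "\<forall>\<^sub>F k in sequentially. dist (xs k) x < e \<and> dist (vs k) v < e \<and>
      ereal (a - e) < g (xs k) \<and> g (xs k) < ereal (a + e)"
    using tendstoD[OF xs e] tendstoD[OF vs e] by eventually_elim blast
  then obtain k where "dist (xs k) x < e \<and> dist (vs k) v < e \<and>
      ereal (a - e) < g (xs k) \<and> g (xs k) < ereal (a + e)"
    using eventually_happens' sequentially_bot by blast
  with fr show ?thesis by blast
qed

text \<open>A diagonal argument: each \<open>vs k\<close> is replaced by a Frechet subgradient whose
  base point, vector and function value are all within \<open>inverse (real (Suc k))\<close> of the
  given ones. It serves to show that a cluster point of the iterates is critical.\<close>

lemma limiting_subdiff_closed:
  assumes g: "proper_fun g" and x: "x \<in> dom_fun g"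
    and xs: "xs \<longlonglongrightarrow> x" and gxs: "(\<lambda>k. g (xs k)) \<longlonglongrightarrow> g x"
    and vs: "\<And>k. vs k \<in> limiting_subdiff g (xs k)" "vs \<longlonglongrightarrow> v"
  shows "v \<in> limiting_subdiff g x"
proof -
  \<comment> \<open>The limiting subdifferential is empty off the domain, so the values along
    \<open>xs\<close> are real and can be perturbed by real errors.\<close>
  have "xs k \<in> dom_fun g" for k
    using vs(1)[of k] by (auto simp: limiting_subdiff_def split: if_splits)
  then have fin: "\<exists>b. g (xs k) = ereal b" for k
    using g by (cases "g (xs k)") (auto simp: proper_fun_def dom_fun_def)
  then obtain b where b: "\<And>k. g (xs k) = ereal (b k)" by metis
  obtain a where a: "g x = ereal a"
    using g x by (cases "g x") (auto simp: proper_fun_def dom_fun_def)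
  have ba: "b \<longlonglongrightarrow> a" using gxs by (simp add: a b)
  have "\<forall>k. \<exists>y u. u \<in> frechet_subdiff g y \<and> dist y (xs k) < inverse (real (Suc k)) \<and>
      dist u (vs k) < inverse (real (Suc k)) \<and>
      ereal (b k - inverse (real (Suc k))) < g y \<and> g y < ereal (b k + inverse (real (Suc k)))"
    using limiting_subdiff_approx[OF vs(1) b] by simp
  then obtain y u where yu: "\<And>k. u k \<in> frechet_subdiff g (y k)"
      "\<And>k. dist (y k) (xs k) < inverse (real (Suc k))"
      "\<And>k. dist (u k) (vs k) < inverse (real (Suc k))"
      "\<And>k. ereal (b k - inverse (real (Suc k))) < g (y k)"
      "\<And>k. g (y k) < ereal (b k + inverse (real (Suc k)))"
    by metis
  have diff0: "(\<lambda>k. p k - q k) \<longlonglongrightarrow> 0"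
    if "\<And>k. dist (p k) (q k) < inverse (real (Suc k))" for p q :: "nat \<Rightarrow> 'a"
    by (rule Lim_null_comparison[OF _ LIMSEQ_inverse_real_of_nat])
      (auto intro!: always_eventually less_imp_le that[unfolded dist_norm] simp del: of_nat_Suc)
  have y: "y \<longlonglongrightarrow> x" by (rule Lim_transform[OF xs diff0[OF yu(2)]])
  have u: "u \<longlonglongrightarrow> v" by (rule Lim_transform[OF vs(2) diff0[OF yu(3)]])
  have gy: "(\<lambda>k. g (y k)) \<longlonglongrightarrow> g x"
  proof (rule tendsto_sandwich)
    show "(\<lambda>k. ereal (b k - inverse (real (Suc k)))) \<longlonglongrightarrow> g x"
      unfolding a using tendsto_diff[OF ba LIMSEQ_inverse_real_of_nat]
      by (intro tendsto_ereal) simp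
    show "(\<lambda>k. ereal (b k + inverse (real (Suc k)))) \<longlonglongrightarrow> g x"
      unfolding a using tendsto_add[OF ba LIMSEQ_inverse_real_of_nat]
      by (intro tendsto_ereal) simp
  qed (auto intro!: always_eventually less_imp_le yu simp del: of_nat_Suc)
  from x y u gy yu(1) show ?thesis
    unfolding limiting_subdiff_def by auto
qed

section \<open>The KL inequality for power functions and one step of descent\<close>

lemma KL_property_with_powr:
  assumes KL: "KL_property_with \<phi> x (\<lambda>a. C * a powr (1 - \<omega>))"
    and C: "0 < C" and \<omega>: "\<omega> < 1" and b: "\<phi> x = ereal b"
  shows "\<exists>\<epsilon>>0. \<exists>\<delta>>0. \<forall>y a v. dist y x < \<epsilon> \<longrightarrow> \<phi> y = ereal a \<longrightarrow> b \<le> a \<longrightarrow> a < b + \<delta> \<longrightarrow>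
           v \<in> limiting_subdiff \<phi> y \<longrightarrow> (a - b) powr \<omega> \<le> C * (1 - \<omega>) * norm v"
proof -
  let ?\<xi> = "\<lambda>a. C * a powr (1 - \<omega>)"
  from KL obtain \<eta> U where \<eta>: "0 < \<eta>" and U: "open U" "x \<in> U"
    and ineq: "\<And>y. y \<in> U \<Longrightarrow> \<phi> x < \<phi> y \<Longrightarrow> \<phi> y < \<phi> x + \<eta> \<Longrightarrow>
       1 \<le> ereal (deriv ?\<xi> (real_of_ereal (\<phi> y - \<phi> x))) * dist_zero (limiting_subdiff \<phi> y)"
    unfolding KL_property_with_def desingularizing_def Let_def by blast
  obtain \<epsilon> where \<epsilon>: "0 < \<epsilon>" "\<And>y. dist y x < \<epsilon> \<Longrightarrow> y \<in> U"
    using U open_dist by metis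
  \<comment> \<open>Since \<open>\<eta>\<close> may be infinite, it is replaced by a smaller
    positive real.\<close>
  obtain \<delta> where \<delta>: "0 < \<delta>" "ereal \<delta> < \<eta>"
    using ereal_dense2[OF \<eta>] by auto
  have "(a - b) powr \<omega> \<le> C * (1 - \<omega>) * norm v"
    if y: "dist y x < \<epsilon>" and a: "\<phi> y = ereal a" "b \<le> a" "a < b + \<delta>"
      and v: "v \<in> limiting_subdiff \<phi> y" for y a v
  proof (cases "a = b")
    case True
    then show ?thesis using C \<omega> by simp
  next
    case False
    define t where "t = a - b"
    have t: "0 < t" using a False by (simp add: t_def)
    have "\<phi> y < \<phi> x + ereal \<delta>" using a b by simp
    also have "\<dots> \<le> \<phi> x + \<eta>" using \<delta> by (intro add_left_mono) simp
    finally have "\<phi> y < \<phi> x + \<eta>" .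
    with ineq[of y] \<epsilon>(2)[OF y] a b False
    have 1: "1 \<le> ereal (deriv ?\<xi> t) * dist_zero (limiting_subdiff \<phi> y)"
      by (simp add: t_def)
    have "(?\<xi> has_real_derivative C * ((1 - \<omega>) * t powr (1 - \<omega> - 1))) (at t)"
      using t by (intro DERIV_cmult has_real_derivative_powr)
    then have d: "deriv ?\<xi> t = C * (1 - \<omega>) * t powr (- \<omega>)"
      by (simp add: DERIV_imp_deriv)
    have d0: "0 \<le> deriv ?\<xi> t" unfolding d using C \<omega> by simp
    have "dist_zero (limiting_subdiff \<phi> y) \<le> ereal (norm v)"
      unfolding dist_zero_def using v by (rule INF_lower)
    then have "ereal (deriv ?\<xi> t) * dist_zero (limiting_subdiff \<phi> y)
        \<le> ereal (deriv ?\<xi> t) * ereal (norm v)"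
      using d0 by (intro ereal_mult_left_mono) auto
    with 1 have "1 \<le> ereal (deriv ?\<xi> t) * ereal (norm v)" by (rule order_trans)
    then have "1 \<le> C * (1 - \<omega>) * t powr (- \<omega>) * norm v" by (simp add: d)
    then have "t powr \<omega> * 1 \<le> t powr \<omega> * (C * (1 - \<omega>) * t powr (- \<omega>) * norm v)"
      by (intro mult_left_mono) auto
    also have "\<dots> = (t powr \<omega> * t powr (- \<omega>)) * (C * (1 - \<omega>) * norm v)"
      by (simp add: algebra_simps)
    also have "t powr \<omega> * t powr (- \<omega>) = 1"
      using t by (simp add: powr_add[symmetric])
    finally show ?thesis by (simp add: t_def)
  qed
  with \<epsilon>(1) \<delta>(1) show ?thesis by blast
qed

text \<open>At \<open>r = 0\<close> the KL hypothesis is harmless even for \<open>\<omega> = 0\<close>, since \<open>0 powr 0 = 0\<close>.\<close>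

lemma powr_descent:
  fixes r s \<zeta> \<zeta>' c \<rho> \<omega> :: real
  assumes \<omega>: "0 \<le> \<omega>" "\<omega> < 1" and \<rho>: "0 < \<rho>" and c: "0 \<le> c" and s: "0 \<le> s"
    and \<zeta>: "0 \<le> \<zeta>" "0 \<le> \<zeta>'"
    and dec: "\<rho> * \<zeta>\<^sup>2 \<le> r - s" and KL: "r powr \<omega> \<le> c * (1 - \<omega>) * \<zeta>'"
  shows "2 * \<zeta> + c / \<rho> * s powr (1 - \<omega>) \<le> \<zeta>' + c / \<rho> * r powr (1 - \<omega>)"
proof -
  have "0 \<le> \<rho> * \<zeta>\<^sup>2" using \<rho> by simp
  with dec have sr: "s \<le> r" by linarith
  define \<Delta> where "\<Delta> = r powr (1 - \<omega>) - s powr (1 - \<omega>)"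
  have \<Delta>: "0 \<le> \<Delta>" unfolding \<Delta>_def using powr_mono2[OF _ s sr, of "1 - \<omega>"] \<omega> by simp
  have amgm: "4 * (x * y) \<le> (x + y)\<^sup>2" for x y :: real
    using zero_le_power2[of "x - y"] by (simp add: power2_eq_square algebra_simps)
  show ?thesis
  proof (cases "r = 0")
    case True
    with s sr have "s = 0" by simp
    with True dec \<rho> have "\<zeta>\<^sup>2 \<le> 0" by (simp add: mult_le_0_iff)
    then have "\<zeta> = 0" by simp
    with True \<open>s = 0\<close> \<zeta> show ?thesis by simp
  next
    case False
    with s sr have r: "0 < r" by simp
    \<comment> \<open>Young's inequality replaces the tangent-line bound for \<open>\<xi>\<close>.\<close>
    have young: "s powr (1 - \<omega>) * r powr \<omega> \<le> (1 - \<omega>) * s + \<omega> * r"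
      using Youngs_inequality_0[of "1 - \<omega>" \<omega> s r] \<omega> r s by (cases "s = 0") auto
    have rr: "r powr \<omega> * r powr (1 - \<omega>) = r" using r by (simp add: powr_add[symmetric])
    have "(1 - \<omega>) * (\<rho> * \<zeta>\<^sup>2) \<le> (1 - \<omega>) * (r - s)"
      using dec \<omega> by (intro mult_left_mono) auto
    also have "\<dots> \<le> r - s powr (1 - \<omega>) * r powr \<omega>" using young by (simp add: algebra_simps)
    also have "\<dots> = r powr \<omega> * \<Delta>" using rr by (simp add: \<Delta>_def algebra_simps)
    also have "\<dots> \<le> c * (1 - \<omega>) * \<zeta>' * \<Delta>" using KL \<Delta> by (rule mult_right_mono)
    finally have "(1 - \<omega>) * (\<rho> * \<zeta>\<^sup>2) \<le> (1 - \<omega>) * (c * \<zeta>' * \<Delta>)" by (simp add: algebra_simps)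
    then have "\<rho> * \<zeta>\<^sup>2 \<le> c * \<zeta>' * \<Delta>" using \<omega> by simp
    \<comment> \<open>AM-GM splits the product into a sum after a square root. The factor 2 it
      leaves on \<open>\<zeta>\<close> is the gain: one copy will pay for the step length, the other
      stays in the potential.\<close>
    then have "4 * \<zeta>\<^sup>2 \<le> 4 * (\<zeta>' * (c / \<rho> * \<Delta>))" using \<rho> by (simp add: field_simps)
    also have "4 * (\<zeta>' * (c / \<rho> * \<Delta>)) \<le> (\<zeta>' + c / \<rho> * \<Delta>)\<^sup>2"
      by (rule amgm)
    finally have "(2 * \<zeta>)\<^sup>2 \<le> (\<zeta>' + c / \<rho> * \<Delta>)\<^sup>2" by (simp add: power_mult_distrib)
    then have "2 * \<zeta> \<le> \<zeta>' + c / \<rho> * \<Delta>"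
      by (rule power2_le_imp_le) (use \<zeta> c \<rho> \<Delta> in simp)
    then show ?thesis by (simp add: \<Delta>_def algebra_simps)
  qed
qed

section \<open>Trapping a sequence by a potential\<close>

text \<open>As long as \<open>z k\<close> lies in the ball, the triangle inequality makes
  \<open>dist (z k) x + V k\<close> nonincreasing. It is below \<open>\<epsilon>\<close> at some
  late index of the subsequence, so the iterates never leave the ball again; from then on
  \<open>V k\<close> bounds the whole remaining length of the path.\<close>

lemma potential_convergence:
  fixes z :: "nat \<Rightarrow> 'a::metric_space"
  assumes V: "\<And>k. 0 \<le> V k" "V \<longlonglongrightarrow> 0"
    and sub: "strict_mono s" "(z \<circ> s) \<longlonglongrightarrow> x" and \<epsilon>: "0 < \<epsilon>"
    and step: "\<forall>\<^sub>F k in sequentially.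
      dist (z k) x < \<epsilon> \<longrightarrow> dist (z k) (z (Suc k)) + V (Suc k) \<le> V k"
  shows "z \<longlonglongrightarrow> x" "\<forall>\<^sub>F k in sequentially. dist (z k) x \<le> V k"
proof -
  define P where "P k = dist (z k) x + V k" for k
  have Ps: "(\<lambda>n. P (s n)) \<longlonglongrightarrow> 0"
    using tendsto_add[OF iffD1[OF tendsto_dist_iff sub(2)] LIMSEQ_subseq_LIMSEQ[OF V(2) sub(1)]]
    by (simp add: P_def o_def)
  from step obtain K where K: "\<And>k. K \<le> k \<Longrightarrow> dist (z k) x < \<epsilon> \<Longrightarrow>
      dist (z k) (z (Suc k)) + V (Suc k) \<le> V k"
    by (auto simp: eventually_sequentially)
  have "\<forall>\<^sub>F n in sequentially. P (s n) < \<epsilon>" using order_tendstoD(2)[OF Ps \<epsilon>] .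
  moreover have "\<forall>\<^sub>F n in sequentially. K \<le> s n"
    using filterlim_subseq[OF sub(1)] by (simp add: filterlim_at_top)
  ultimately have "\<forall>\<^sub>F n in sequentially. P (s n) < \<epsilon> \<and> K \<le> s n" by eventually_elim simp
  then obtain n0 where n0: "P (s n0) < \<epsilon>" "K \<le> s n0"
    using eventually_happens' sequentially_bot by blast
  define K0 where "K0 = s n0"
  have inv: "P (Suc k) \<le> P k" if "K0 \<le> k" "P k < \<epsilon>" for k
  proof -
    have "dist (z k) x < \<epsilon>" using that V(1)[of k] by (simp add: P_def)
    from K[OF _ this] that n0 have "dist (z k) (z (Suc k)) + V (Suc k) \<le> V k"
      by (simp add: K0_def)
    moreover have "dist (z (Suc k)) x \<le> dist (z k) (z (Suc k)) + dist (z k) x"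
      by (metis dist_commute dist_triangle)
    ultimately show ?thesis by (simp add: P_def)
  qed
  have P\<epsilon>: "P k < \<epsilon>" if "K0 \<le> k" for k
    using that
  proof (induction rule: dec_induct)
    case base
    then show ?case using n0 by (simp add: K0_def)
  next
    case (step k)
    then show ?case using inv[of k] by simp
  qed
  \<comment> \<open>Telescoping of \<open>K\<close>, whose ball condition \<open>P\<epsilon>\<close>
    now guarantees. Letting \<open>m\<close> run through the subsequence turns this into a bound on
    the distance to \<open>x\<close>.\<close>
  have dV: "dist (z k) (z m) + V m \<le> V k" if "K0 \<le> k" "k \<le> m" for k m
    using that(2)
  proof (induction rule: dec_induct)
    case (step m)
    have "dist (z m) x < \<epsilon>" using P\<epsilon>[of m] V(1)[of m] step that(1) by (simp add: P_def)
    from K[OF _ this] step that(1) n0 have "dist (z m) (z (Suc m)) + V (Suc m) \<le> V m"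
      by (simp add: K0_def)
    with step.IH dist_triangle[of "z k" "z (Suc m)" "z m"] show ?case by simp
  qed simp
  have bound: "dist (z k) x \<le> V k" if k: "K0 \<le> k" for k
  proof (rule tendsto_upperbound)
    show "(\<lambda>n. dist (z k) ((z \<circ> s) n)) \<longlonglongrightarrow> dist (z k) x"
      by (intro tendsto_intros sub)
    show "\<forall>\<^sub>F n in sequentially. dist (z k) ((z \<circ> s) n) \<le> V k"
    proof (rule eventually_sequentiallyI)
      fix n assume "k \<le> n"
      then have "k \<le> s n" using seq_suble[OF sub(1), of n] by simp
      from dV[OF k this] V(1)[of "s n"] show "dist (z k) ((z \<circ> s) n) \<le> V k" by simp
    qed
  qed simp
  then show ev: "\<forall>\<^sub>F k in sequentially. dist (z k) x \<le> V k"
    by (rule eventually_sequentiallyI)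
  show "z \<longlonglongrightarrow> x"
    unfolding tendsto_dist_iff[of z]
    by (rule tendsto_sandwich[OF _ ev tendsto_const V(2)]) simp
qed

section \<open>Decay of scalar recursions\<close>

text \<open>Follows from ln (1+x) \<le> x and 1+y \<le> exp y. It limits how fast the comparison
  sequence k^(-\<beta>) can drop in one step.\<close>

lemma bernoulli_powr_neg:
  fixes x \<beta> :: real
  assumes x: "0 \<le> x" and \<beta>: "0 \<le> \<beta>"
  shows "1 - \<beta> * x \<le> (1 + x) powr (- \<beta>)"
proof -
  have "\<beta> * ln (1 + x) \<le> \<beta> * x"
    using ln_add_one_self_le_self[OF x] \<beta> by (rule mult_left_mono)
  then have "1 - \<beta> * x \<le> 1 + (- \<beta> * ln (1 + x))" by simp
  also have "\<dots> \<le> exp (- \<beta> * ln (1 + x))" by (rule exp_ge_add_one_self)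
  also have "\<dots> = (1 + x) powr (- \<beta>)" using x by (simp add: powr_def)
  finally show ?thesis .
qed

lemma geometric_rate:
  fixes r :: "nat \<Rightarrow> real"
  assumes B: "0 \<le> B"
    and rec: "\<And>k. K \<le> k \<Longrightarrow> r (Suc k) \<le> B * (r k - r (Suc k))" and k: "K \<le> k"
  shows "r k \<le> r K * (B / (1 + B)) ^ (k - K)"
  using k
proof (induction rule: dec_induct)
  case (step k)
  have "(1 + B) * r (Suc k) \<le> B * r k" using rec[of k] step by (simp add: algebra_simps)
  then have "r (Suc k) \<le> B / (1 + B) * r k" using B by (simp add: field_simps)
  also have "\<dots> \<le> B / (1 + B) * (r K * (B / (1 + B)) ^ (k - K))"
    using step.IH B by (intro mult_left_mono) auto
  finally show ?case using step by (simp add: Suc_diff_le mult_ac)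
qed simp

text \<open>The exponent is written 1 + 1/\<beta> because the continuous analogue B r' =
  -r^(1+1/\<beta>) has solutions of the form c t^(-\<beta>) with c^(1/\<beta>) = B \<beta>. The
  proof compares \<open>r\<close> with such a power by induction, starting at \<open>Suc K\<close>
  to avoid the index 0.\<close>

lemma sublinear_rate:
  fixes r :: "nat \<Rightarrow> real"
  assumes r: "\<And>k. 0 \<le> r k" and B: "0 < B" and \<beta>: "0 < \<beta>"
    and rec: "\<And>k. K \<le> k \<Longrightarrow> r (Suc k) powr (1 + 1 / \<beta>) \<le> B * (r k - r (Suc k))"
  shows "\<exists>c>0. \<forall>k\<ge>Suc K. r k \<le> c * real k powr (- \<beta>)"
proof -
  \<comment> \<open>The constant makes \<open>c * k powr - \<beta>\<close> a supersolution of the recursion, by Bernoulli and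
    \<open>k + 1 \<le> 2 * k\<close>.\<close>
  define c0 where "c0 = (B * \<beta> * 2 powr (\<beta> + 1)) powr \<beta>"
  define c where "c = c0 + r (Suc K) * real (Suc K) powr \<beta>"
  have c0: "0 < c0" using B \<beta> by (simp add: c0_def)
  have c0c: "c0 \<le> c" using r by (simp add: c_def)
  have c: "0 < c" using c0 c0c by simp
  have "B * \<beta> * 2 powr (\<beta> + 1) = c0 powr (1 / \<beta>)"
    using B \<beta> by (simp add: c0_def powr_powr)
  also have "\<dots> \<le> c powr (1 / \<beta>)" using c0 c0c \<beta> by (intro powr_mono2) auto
  finally have c': "B * \<beta> * 2 powr (\<beta> + 1) \<le> c powr (1 / \<beta>)" .
  have "r k \<le> c * real k powr (- \<beta>)" if "Suc K \<le> k" for k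
    using that
  proof (induction rule: dec_induct)
    case base
    \<comment> \<open>The second summand of \<open>c\<close> was chosen for this base case.\<close>
    have "r (Suc K) = r (Suc K) * real (Suc K) powr \<beta> * real (Suc K) powr (- \<beta>)"
      by (simp add: powr_add[symmetric] mult.assoc)
    also have "\<dots> \<le> c * real (Suc K) powr (- \<beta>)"
      using c0 by (intro mult_right_mono) (auto simp: c_def)
    finally show ?case .
  next
    case (step k)
    define n where "n = real k"
    have n: "1 \<le> n" and Sn: "real (Suc k) = n + 1" using step by (auto simp: n_def)
    show ?case
    \<comment> \<open>If \<open>r (Suc k)\<close> exceeded the comparison value, then by the
      induction hypothesis the drop of \<open>r\<close> would be strictly smaller than that of the
      comparison sequence, while the left side of \<open>rec\<close> would be at least as large.
      That contradicts the supersolution property.\<close>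
    proof (rule ccontr)
      assume "\<not> ?thesis"
      then have gt: "c * (n + 1) powr (- \<beta>) < r (Suc k)" unfolding Sn by simp
      have e: "(n + 1) powr (- \<beta>) = n powr (- \<beta>) * (1 + 1 / n) powr (- \<beta>)"
      proof -
        have "n + 1 = n * (1 + 1 / n)" using n by (simp add: field_simps)
        then show ?thesis using n by (simp only: powr_mult)
      qed
      have "n powr (- \<beta>) * (1 - \<beta> * (1 / n)) \<le> (n + 1) powr (- \<beta>)"
        unfolding e using n \<beta> by (intro mult_left_mono bernoulli_powr_neg) auto
      moreover have "n powr (- \<beta>) * (1 / n) = n powr (- \<beta> - 1)"
        using n by (simp add: powr_diff)
      moreover have "n powr (- \<beta>) * (1 - \<beta> * (1 / n))
          = n powr (- \<beta>) - \<beta> * (n powr (- \<beta>) * (1 / n))"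
        by (simp add: algebra_simps)
      ultimately have diff: "n powr (- \<beta>) - (n + 1) powr (- \<beta>) \<le> \<beta> * n powr (- \<beta> - 1)"
        by simp
      have "n powr (- \<beta> - 1) = 2 powr (\<beta> + 1) * (2 * n) powr (- \<beta> - 1)"
        using n by (simp add: powr_mult powr_minus_divide[of 2 "\<beta> + 1"] field_simps
            flip: powr_add)
      also have "\<dots> \<le> 2 powr (\<beta> + 1) * (n + 1) powr (- \<beta> - 1)"
        using n \<beta> by (intro mult_left_mono powr_mono2') auto
      finally have dbl: "n powr (- \<beta> - 1) \<le> 2 powr (\<beta> + 1) * (n + 1) powr (- \<beta> - 1)" .
      have "(c * (n + 1) powr (- \<beta>)) powr (1 + 1 / \<beta>)
          = c powr (1 + 1 / \<beta>) * (n + 1) powr (- \<beta> * (1 + 1 / \<beta>))"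
        using c by (simp add: powr_mult powr_powr)
      also have "- \<beta> * (1 + 1 / \<beta>) = - \<beta> - 1" using \<beta> by (simp add: field_simps)
      also have "c powr (1 + 1 / \<beta>) = c * c powr (1 / \<beta>)" using c by (simp add: powr_add)
      finally have "c * c powr (1 / \<beta>) * (n + 1) powr (- \<beta> - 1)
          = (c * (n + 1) powr (- \<beta>)) powr (1 + 1 / \<beta>)" by simp
      also have "\<dots> \<le> r (Suc k) powr (1 + 1 / \<beta>)"
        using gt c \<beta> by (intro powr_mono2) auto
      also have "\<dots> \<le> B * (r k - r (Suc k))" using rec[of k] step by simp
      also have "\<dots> < B * (c * n powr (- \<beta>) - c * (n + 1) powr (- \<beta>))"
        using step.IH gt B by (intro mult_strict_left_mono) (auto simp: n_def)
      also have "\<dots> = B * c * (n powr (- \<beta>) - (n + 1) powr (- \<beta>))" by (simp add: algebra_simps)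
      also have "\<dots> \<le> B * c * (\<beta> * (2 powr (\<beta> + 1) * (n + 1) powr (- \<beta> - 1)))"
        using order_trans[OF diff mult_left_mono[OF dbl]] B c \<beta>
        by (intro mult_left_mono) auto
      also have "\<dots> = c * (B * \<beta> * 2 powr (\<beta> + 1)) * (n + 1) powr (- \<beta> - 1)" by simp
      also have "\<dots> \<le> c * c powr (1 / \<beta>) * (n + 1) powr (- \<beta> - 1)"
        using c' c by (intro mult_right_mono mult_left_mono) auto
      finally show False by simp
    qed
  qed
  with c show ?thesis by blast
qed

text \<open>The finitely many early indices are absorbed into the constant: \<open>S\<close>
  dominates each ratio \<open>f i / g i\<close> with \<open>i < K\<close>, and the summand 1 makes
  the constant positive. Index 0 is left out since \<open>real k powr (- \<gamma>)\<close> vanishes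
  there.\<close>

lemma eventually_le_imp_bound:
  fixes f g :: "nat \<Rightarrow> real"
  assumes ev: "\<forall>\<^sub>F k in sequentially. f k \<le> D * g k" and g: "\<And>k. 1 \<le> k \<Longrightarrow> 0 < g k"
  shows "\<exists>D'>0. \<forall>k\<ge>1. f k \<le> D' * g k"
proof -
  from ev obtain K where K: "\<And>k. K \<le> k \<Longrightarrow> f k \<le> D * g k"
    by (auto simp: eventually_sequentially)
  define S where "S = (\<Sum>i<K. \<bar>f i / g i\<bar>)"
  have S: "0 \<le> S" unfolding S_def by (rule sum_nonneg) simp
  have "f k \<le> (\<bar>D\<bar> + 1 + S) * g k" if k: "1 \<le> k" for k
  proof (cases "k < K")
    case True
    have "f k / g k \<le> \<bar>f k / g k\<bar>" by (rule abs_ge_self)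
    also have "\<dots> \<le> S" unfolding S_def by (rule member_le_sum) (use True in auto)
    finally have "f k / g k \<le> \<bar>D\<bar> + 1 + S" by simp
    then show ?thesis using g[OF k] by (simp add: divide_le_eq)
  next
    case False
    then have "f k \<le> D * g k" using K by simp
    also have "\<dots> \<le> (\<bar>D\<bar> + 1 + S) * g k"
      using g[OF k] S by (intro mult_right_mono) auto
    finally show ?thesis .
  qed
  moreover have "0 < \<bar>D\<bar> + 1 + S" using S by simp
  ultimately show ?thesis by blast
qed

section \<open>Consequences of sufficient decrease\<close>

lemma descent_gap_tendsto_0:
  fixes r \<zeta> :: "nat \<Rightarrow> real"
  assumes r: "r \<longlonglongrightarrow> l" and \<rho>: "0 < \<rho>" and \<zeta>: "\<And>k. 0 \<le> \<zeta> k"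
    and dec: "\<And>k. \<rho> * (\<zeta> k)\<^sup>2 \<le> r k - r (Suc k)"
  shows "\<zeta> \<longlonglongrightarrow> 0"
proof -
  have "(\<lambda>k. (r k - r (Suc k)) / \<rho>) \<longlonglongrightarrow> (l - l) / \<rho>"
    using \<rho> by (intro tendsto_intros r LIMSEQ_Suc) simp
  then have lim: "(\<lambda>k. (r k - r (Suc k)) / \<rho>) \<longlonglongrightarrow> 0" by simp
  have "(\<lambda>k. (\<zeta> k)\<^sup>2) \<longlonglongrightarrow> 0"
    by (rule tendsto_sandwich[OF _ _ tendsto_const lim])
      (use dec \<rho> in \<open>auto intro!: always_eventually simp: field_simps\<close>)
  from tendsto_real_sqrt[OF this] show ?thesis using \<zeta> by simp
qed

text \<open>Sufficient decrease bounds \<open>\<zeta> k\<close> by a multiple of the square root of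
  \<open>r k\<close>, and monotonicity bounds the other summand by \<open>r k powr p\<close>. Once
  \<open>r k < 1\<close>, any exponent below both is weaker, so the potential is controlled by
  \<open>r k\<close> alone.\<close>

lemma descent_potential_bound:
  fixes r \<zeta> :: "nat \<Rightarrow> real"
  assumes r: "\<And>k. 0 \<le> r k" "r \<longlonglongrightarrow> 0" and \<rho>: "0 < \<rho>" and b: "0 \<le> b"
    and dec: "\<And>k. \<rho> * (\<zeta> k)\<^sup>2 \<le> r k - r (Suc k)" and \<zeta>: "\<And>k. 0 \<le> \<zeta> k"
    and \<theta>: "0 \<le> \<theta>" "\<theta> \<le> 1 / 2" "\<theta> \<le> p"
  shows "\<forall>\<^sub>F k in sequentially. \<zeta> k + b * r (Suc k) powr p \<le> (1 / sqrt \<rho> + b) * r k powr \<theta>"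
  using order_tendstoD(2)[OF r(2) zero_less_one]
proof eventually_elim
  fix k assume r1: "r k < 1"
  have "0 \<le> \<rho> * (\<zeta> k)\<^sup>2" using \<rho> by simp
  with dec[of k] have Suc: "r (Suc k) \<le> r k" by linarith
  have "(\<zeta> k)\<^sup>2 \<le> r k / \<rho>" using dec[of k] r(1)[of "Suc k"] \<rho> by (simp add: field_simps)
  then have "\<zeta> k \<le> sqrt (r k / \<rho>)" by (rule real_le_rsqrt)
  also have "\<dots> = 1 / sqrt \<rho> * r k powr (1 / 2)"
    using r(1) by (simp add: real_sqrt_divide powr_half_sqrt)
  also have "\<dots> \<le> 1 / sqrt \<rho> * r k powr \<theta>"
    using r(1)[of k] r1 \<theta> \<rho> by (intro mult_left_mono powr_mono') auto
  finally have 1: "\<zeta> k \<le> 1 / sqrt \<rho> * r k powr \<theta>" .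
  have "r (Suc k) powr p \<le> r k powr p" using r(1) Suc \<theta> by (intro powr_mono2) auto
  also have "\<dots> \<le> r k powr \<theta>" using r(1)[of k] r1 \<theta> by (intro powr_mono') auto
  finally have "b * r (Suc k) powr p \<le> b * r k powr \<theta>" using b by (rule mult_left_mono)
  with 1 show "\<zeta> k + b * r (Suc k) powr p \<le> (1 / sqrt \<rho> + b) * r k powr \<theta>"
    by (simp add: algebra_simps)
qed

lemma descent_recursion:
  fixes r s \<zeta> \<rho> c \<omega> :: real
  assumes s: "0 \<le> s" and \<rho>: "0 < \<rho>" and KL: "s powr \<omega> \<le> c * \<zeta>" and dec: "\<rho> * \<zeta>\<^sup>2 \<le> r - s"
  shows "s powr (2 * \<omega>) \<le> c\<^sup>2 / \<rho> * (r - s)"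
proof -
  have "s powr (2 * \<omega>) = (s powr \<omega>)\<^sup>2" by (simp add: power2_eq_square flip: powr_add)
  also have "\<dots> \<le> (c * \<zeta>)\<^sup>2" using KL by (intro power_mono) auto
  also have "\<dots> = c\<^sup>2 / \<rho> * (\<rho> * \<zeta>\<^sup>2)" using \<rho> by (simp add: power_mult_distrib)
  also have "\<dots> \<le> c\<^sup>2 / \<rho> * (r - s)" using dec \<rho> by (intro mult_left_mono) auto
  finally show ?thesis .
qed

section \<open>Convergence to a critical point\<close>

text \<open>Collects what the three regimes share: a recursion for the gap \<open>r\<close> and a
  bound of the distance to the limit by a power of \<open>r\<close>. The KL form is assumed on the
  whole domain of the subdifferential, with \<open>C\<close> depending on the point, because the
  cluster point is not known beforehand.\<close>

lemma KL_descent_convergence: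
  fixes \<Phi> :: "'a::euclidean_space \<Rightarrow> ereal"
  assumes proper: "proper_fun \<Phi>"
    and bounded_below: "\<And>x. ereal m \<le> \<Phi> x"
    and bounded_seq: "bounded (range z)"
    and rho_pos: "\<rho>1 > 0" "\<rho>2 > 0" "\<rho>3 > 0"
    and zeta_nonneg: "\<And>k. \<zeta> k \<ge> 0"
    and step: "\<And>k. \<rho>1 * (norm (z k - z (Suc k)))\<^sup>2 \<le> \<rho>2 * (\<zeta> k)\<^sup>2"
    and dec: "\<And>k. ereal (\<rho>2 * (\<zeta> k)\<^sup>2) \<le> \<Phi> (z k) - \<Phi> (z (Suc k))"
    and w: "\<And>k. w k \<in> limiting_subdiff \<Phi> (z k)" "\<And>k. norm (w (Suc k)) \<le> \<rho>3 * \<zeta> k"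
    and B4: "\<And>r y. strict_mono r \<Longrightarrow> (\<lambda>n. z (r n)) \<longlonglongrightarrow> y \<Longrightarrow>
                 (\<lambda>n. \<Phi> (z (r n))) \<longlonglongrightarrow> \<Phi> y"
    and omega: "0 \<le> \<omega>" "\<omega> < 1"
    and KL_form: "\<And>x. x \<in> dom_subdiff \<Phi> \<Longrightarrow>
                 \<exists>C>0. KL_property_with \<Phi> x (\<lambda>a. C * a powr (1 - \<omega>))"
  obtains zbar r B D where "z \<longlonglongrightarrow> zbar" "\<And>k. 0 \<le> r k" "r \<longlonglongrightarrow> 0" "0 < B" "0 \<le> D"
    "\<forall>\<^sub>F k in sequentially. r (Suc k) powr (2 * \<omega>) \<le> B * (r k - r (Suc k))"
    "\<forall>\<^sub>F k in sequentially. norm (z (Suc k) - zbar) \<le> D * r k powr (min (1 / 2) (1 - \<omega>))"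
proof -
  \<comment> \<open>Having a subgradient puts every iterate in the domain, so the values of
    \<open>\<Phi>\<close> along the sequence are real.\<close>
  have "z k \<in> dom_fun \<Phi>" for k
    using w(1)[of k] by (auto simp: limiting_subdiff_def split: if_splits)
  then have "\<exists>b. \<Phi> (z k) = ereal b" for k
    using proper by (cases "\<Phi> (z k)") (auto simp: proper_fun_def dom_fun_def)
  then obtain f where f: "\<And>k. \<Phi> (z k) = ereal (f k)" by metis
  have fdec: "\<rho>2 * (\<zeta> k)\<^sup>2 \<le> f k - f (Suc k)" for k using dec[of k] by (simp add: f)
  have fdec0: "f (Suc k) \<le> f k" for k
  proof -
    have "0 \<le> \<rho>2 * (\<zeta> k)\<^sup>2" using rho_pos by simp
    with fdec[of k] show ?thesis by linarith
  qed
  have fm: "m \<le> f k" for k using bounded_below[of "z k"] by (simp add: f)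
  have "decseq f" by (rule decseq_SucI) (rule fdec0)
  then obtain L where L: "f \<longlonglongrightarrow> L" "\<And>k. L \<le> f k"
    using decseq_convergent[of f m] fm by blast
  have \<zeta>0: "\<zeta> \<longlonglongrightarrow> 0" by (rule descent_gap_tendsto_0[of f L \<rho>2 \<zeta>, OF L(1) rho_pos(2) zeta_nonneg fdec])
  obtain zbar s where s: "strict_mono s" and zs: "(z \<circ> s) \<longlonglongrightarrow> zbar"
    using bounded_imp_convergent_subsequence[OF bounded_seq] by blast
  have \<Phi>s: "(\<lambda>n. \<Phi> (z (s n))) \<longlonglongrightarrow> \<Phi> zbar" using B4[OF s] zs by (simp add: o_def)
  have "(\<lambda>n. \<Phi> (z (s n))) \<longlonglongrightarrow> ereal L"
    unfolding f using LIMSEQ_subseq_LIMSEQ[OF L(1) s] by (simp add: o_def)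
  \<comment> \<open>(B4) along the subsequence identifies the limit \<open>L\<close> of the function
    values with the value at the cluster point.\<close>
  then have \<Phi>L: "\<Phi> zbar = ereal L" using LIMSEQ_unique[OF \<Phi>s] by simp
  have "(\<lambda>k. norm (w (Suc k))) \<longlonglongrightarrow> 0"
    by (rule tendsto_sandwich[OF _ _ tendsto_const tendsto_mult_right_zero[OF \<zeta>0, of \<rho>3]])
      (use w(2) in auto)
  then have "(\<lambda>k. norm (w k)) \<longlonglongrightarrow> 0" by (rule LIMSEQ_imp_Suc)
  then have "w \<longlonglongrightarrow> 0" by (rule tendsto_norm_zero_cancel)
  then have ws: "(\<lambda>n. w (s n)) \<longlonglongrightarrow> 0" using LIMSEQ_subseq_LIMSEQ[OF _ s] by (simp add: o_def)
  have "0 \<in> limiting_subdiff \<Phi> zbar"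
    by (rule limiting_subdiff_closed[OF proper _ zs[unfolded o_def] \<Phi>s w(1) ws])
      (simp add: dom_fun_def \<Phi>L)
  then obtain C where C: "0 < C" and KL: "KL_property_with \<Phi> zbar (\<lambda>a. C * a powr (1 - \<omega>))"
    using KL_form[of zbar] by (auto simp: dom_subdiff_def)
  from KL_property_with_powr[OF KL C omega(2) \<Phi>L] obtain \<epsilon> \<delta> where \<epsilon>: "0 < \<epsilon>" and \<delta>: "0 < \<delta>"
    and KL': "\<forall>y a v. dist y zbar < \<epsilon> \<longrightarrow> \<Phi> y = ereal a \<longrightarrow> L \<le> a \<longrightarrow> a < L + \<delta> \<longrightarrow>
           v \<in> limiting_subdiff \<Phi> y \<longrightarrow> (a - L) powr \<omega> \<le> C * (1 - \<omega>) * norm v"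
    by (elim exE conjE) (rule that)
  define r where "r k = f k - L" for k
  \<comment> \<open>\<open>c\<close> merges the KL constant with (B2), and \<open>a\<close> converts
    \<open>\<zeta>\<close> into step length by (B1). In \<open>V\<close> the index is
    \<open>k - 1\<close> because (B2) bounds the subgradient at \<open>z k\<close> by
    \<open>\<zeta> (k - 1)\<close>; the truncated value at \<open>k = 0\<close> is harmless, as only
    late indices are used.\<close>
  define c where "c = C * \<rho>3"
  define a where "a = sqrt (\<rho>2 / \<rho>1)"
  define V where "V k = a * (\<zeta> (k - 1) + c / \<rho>2 * r k powr (1 - \<omega>))" for k
  have a: "0 < a" and c: "0 < c" using rho_pos C by (simp_all add: a_def c_def)
  have r0: "0 \<le> r k" for k using L(2) by (simp add: r_def)
  have rlim: "r \<longlonglongrightarrow> 0" unfolding r_def using tendsto_diff[OF L(1) tendsto_const, of L] by simp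
  have rdec: "\<rho>2 * (\<zeta> k)\<^sup>2 \<le> r k - r (Suc k)" for k using fdec by (simp add: r_def)
  have "\<forall>\<^sub>F k in sequentially. r (Suc k) < \<delta>"
    using order_tendstoD(2)[OF LIMSEQ_Suc[OF rlim] \<delta>] .
  then have KLk: "\<forall>\<^sub>F k in sequentially. dist (z (Suc k)) zbar < \<epsilon> \<longrightarrow>
      r (Suc k) powr \<omega> \<le> c * (1 - \<omega>) * \<zeta> k"
  proof (eventually_elim, intro impI)
    fix k assume "r (Suc k) < \<delta>" "dist (z (Suc k)) zbar < \<epsilon>"
    then have "r (Suc k) powr \<omega> \<le> C * (1 - \<omega>) * norm (w (Suc k))"
      using KL'[rule_format, of "z (Suc k)" "f (Suc k)" "w (Suc k)"] f L(2) w(1) by (simp add: r_def)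
    also have "\<dots> \<le> C * (1 - \<omega>) * (\<rho>3 * \<zeta> k)"
      using w(2) C omega by (intro mult_left_mono) auto
    finally show "r (Suc k) powr \<omega> \<le> c * (1 - \<omega>) * \<zeta> k" by (simp add: c_def mult_ac)
  qed
  have dz: "dist (z k) (z (Suc k)) \<le> a * \<zeta> k" for k
  proof (rule power2_le_imp_le)
    show "(dist (z k) (z (Suc k)))\<^sup>2 \<le> (a * \<zeta> k)\<^sup>2"
      using step[of k] rho_pos by (simp add: a_def power_mult_distrib dist_norm field_simps)
  qed (use a zeta_nonneg in simp)
  have V0: "0 \<le> V k" for k using a c rho_pos zeta_nonneg by (simp add: V_def)
  have "(\<lambda>k. r (Suc k) powr (1 - \<omega>)) \<longlonglongrightarrow> 0"
    by (rule tendsto_zero_powrI[OF LIMSEQ_Suc[OF rlim] tendsto_const]) (use r0 omega in simp_all)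
  from tendsto_mult_left[OF tendsto_add[OF \<zeta>0 tendsto_mult_left[OF this, of "c / \<rho>2"]], of a]
  have "(\<lambda>k. V (Suc k)) \<longlonglongrightarrow> a * (0 + c / \<rho>2 * 0)"
    unfolding V_def diff_Suc_1 .
  then have "(\<lambda>k. V (Suc k)) \<longlonglongrightarrow> 0" by simp
  then have Vlim: "V \<longlonglongrightarrow> 0" by (rule LIMSEQ_imp_Suc)
  have "\<forall>\<^sub>F k in sequentially. dist (z (Suc k)) zbar < \<epsilon> \<longrightarrow>
      dist (z (Suc k)) (z (Suc (Suc k))) + V (Suc (Suc k)) \<le> V (Suc k)"
    using KLk
  proof (eventually_elim, intro impI)
    fix k assume *: "dist (z (Suc k)) zbar < \<epsilon> \<longrightarrow> r (Suc k) powr \<omega> \<le> c * (1 - \<omega>) * \<zeta> k"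
      and near: "dist (z (Suc k)) zbar < \<epsilon>"
    have "2 * \<zeta> (Suc k) + c / \<rho>2 * r (Suc (Suc k)) powr (1 - \<omega>)
        \<le> \<zeta> k + c / \<rho>2 * r (Suc k) powr (1 - \<omega>)"
      by (rule powr_descent[OF omega rho_pos(2) less_imp_le[OF c] r0 zeta_nonneg zeta_nonneg
            rdec mp[OF * near]])
    \<comment> \<open>Of the two copies of \<open>a * \<zeta> (Suc k)\<close>, one covers the step
      by \<open>dz\<close> and the other belongs to \<open>V (Suc (Suc k))\<close>.\<close>
    then have "a * (2 * \<zeta> (Suc k) + c / \<rho>2 * r (Suc (Suc k)) powr (1 - \<omega>)) \<le> V (Suc k)"
      unfolding V_def diff_Suc_1 using a by (intro mult_left_mono) auto
    with dz[of "Suc k"] show "dist (z (Suc k)) (z (Suc (Suc k))) + V (Suc (Suc k)) \<le> V (Suc k)"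
      by (simp add: V_def algebra_simps)
  qed
  then have "\<forall>\<^sub>F k in sequentially. dist (z k) zbar < \<epsilon> \<longrightarrow>
      dist (z k) (z (Suc k)) + V (Suc k) \<le> V k"
    by (subst (asm) eventually_sequentially_Suc)
  note conv = potential_convergence[OF V0 Vlim s zs \<epsilon> this]
  have "\<forall>\<^sub>F k in sequentially. dist (z (Suc k)) zbar \<le> V (Suc k)"
    using conv(2) by (subst eventually_sequentially_Suc)
  moreover have "\<forall>\<^sub>F k in sequentially.
      \<zeta> k + c / \<rho>2 * r (Suc k) powr (1 - \<omega>)
        \<le> (1 / sqrt \<rho>2 + c / \<rho>2) * r k powr (min (1 / 2) (1 - \<omega>))"
    by (rule descent_potential_bound[OF r0 rlim rho_pos(2) _ rdec zeta_nonneg _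
          min.cobounded1 min.cobounded2])
      (use c rho_pos(2) omega in simp_all)
  ultimately have bound: "\<forall>\<^sub>F k in sequentially. norm (z (Suc k) - zbar)
      \<le> a * (1 / sqrt \<rho>2 + c / \<rho>2) * r k powr (min (1 / 2) (1 - \<omega>))"
  proof eventually_elim
    fix k assume "dist (z (Suc k)) zbar \<le> V (Suc k)"
      and le: "\<zeta> k + c / \<rho>2 * r (Suc k) powr (1 - \<omega>)
        \<le> (1 / sqrt \<rho>2 + c / \<rho>2) * r k powr (min (1 / 2) (1 - \<omega>))"
    then have "norm (z (Suc k) - zbar) \<le> a * (\<zeta> k + c / \<rho>2 * r (Suc k) powr (1 - \<omega>))"
      by (simp add: V_def dist_norm)
    also have "\<dots> \<le> a * ((1 / sqrt \<rho>2 + c / \<rho>2) * r k powr (min (1 / 2) (1 - \<omega>)))"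
      using le less_imp_le[OF a] by (rule mult_left_mono)
    finally show "norm (z (Suc k) - zbar)
        \<le> a * (1 / sqrt \<rho>2 + c / \<rho>2) * r k powr (min (1 / 2) (1 - \<omega>))"
      by (simp only: mult.assoc)
  qed
  \<comment> \<open>Convergence of the full sequence discharges the ball condition in
    \<open>KLk\<close>.\<close>
  have "\<forall>\<^sub>F k in sequentially. dist (z (Suc k)) zbar < \<epsilon>"
    using tendstoD[OF LIMSEQ_Suc[OF conv(1)] \<epsilon>] .
  with KLk have rec: "\<forall>\<^sub>F k in sequentially.
      r (Suc k) powr (2 * \<omega>) \<le> (c * (1 - \<omega>))\<^sup>2 / \<rho>2 * (r k - r (Suc k))"
    by eventually_elim (rule descent_recursion[OF r0 rho_pos(2) mp rdec])
  show thesis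
  proof (rule that[OF conv(1) r0 rlim _ _ rec bound])
    show "0 < (c * (1 - \<omega>))\<^sup>2 / \<rho>2" "0 \<le> a * (1 / sqrt \<rho>2 + c / \<rho>2)"
      using a c rho_pos omega by simp_all
  qed
qed

section \<open>The three convergence regimes\<close>

text \<open>With exponent 0 the recursion forces a drop of size at least 1/B whenever
  \<open>r (Suc k)\<close> is nonzero, but the drops tend to 0. Hence \<open>r\<close> vanishes from
  some index on, and \<open>0 powr \<theta> = 0\<close> stops the iterates one index later.\<close>

lemma finite_convergence:
  fixes r :: "nat \<Rightarrow> real" and z :: "nat \<Rightarrow> 'a::real_normed_vector"
  assumes r: "\<And>k. 0 \<le> r k" "r \<longlonglongrightarrow> 0"
    and rec: "\<forall>\<^sub>F k in sequentially. r (Suc k) powr 0 \<le> B * (r k - r (Suc k))"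
    and z: "\<forall>\<^sub>F k in sequentially. norm (z (Suc k) - x) \<le> D * r k powr \<theta>"
  shows "\<exists>K. \<forall>k\<ge>K. z k = x"
proof -
  have "(\<lambda>k. B * (r k - r (Suc k))) \<longlonglongrightarrow> 0"
    using tendsto_mult_right_zero[OF tendsto_diff[OF r(2) LIMSEQ_Suc[OF r(2)], simplified], of B] .
  then have "\<forall>\<^sub>F k in sequentially. B * (r k - r (Suc k)) < 1" by (rule order_tendstoD) simp
  with rec have "\<forall>\<^sub>F k in sequentially. r (Suc k) = 0"
  proof eventually_elim
    fix k assume "r (Suc k) powr 0 \<le> B * (r k - r (Suc k))" "B * (r k - r (Suc k)) < 1"
    then have "\<not> 0 < r (Suc k)" by auto
    then show "r (Suc k) = 0" using r(1)[of "Suc k"] by simp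
  qed
  then have "\<forall>\<^sub>F k in sequentially. r k = 0" by (subst (asm) eventually_sequentially_Suc)
  with z have "\<forall>\<^sub>F k in sequentially. z (Suc k) = x" by eventually_elim simp
  then have "\<forall>\<^sub>F k in sequentially. z k = x"
    unfolding eventually_sequentially_Suc[of "\<lambda>k. z k = x"] .
  then show ?thesis by (simp add: eventually_sequentially)
qed

text \<open>Once \<open>r (Suc k) < 1\<close>, the assumption 2\<omega> \<le> 1 makes r \<le>
  r^(2\<omega>), so the recursion becomes linear and \<open>r\<close> decays like
  \<open>q ^ k\<close>. The distance is of the order of the square root of \<open>r\<close>, hence
  the ratio \<open>sqrt q\<close>.\<close>

lemma linear_convergence:
  fixes r :: "nat \<Rightarrow> real" and z :: "nat \<Rightarrow> 'a::real_normed_vector"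
  assumes r: "\<And>k. 0 \<le> r k" "r \<longlonglongrightarrow> 0" and B: "0 < B" and D: "0 \<le> D"
    and rec: "\<forall>\<^sub>F k in sequentially. r (Suc k) powr (2 * \<omega>) \<le> B * (r k - r (Suc k))"
    and z: "\<forall>\<^sub>F k in sequentially. norm (z (Suc k) - x) \<le> D * r k powr (1 / 2)"
    and \<omega>: "\<omega> \<le> 1 / 2"
  shows "\<exists>D' q. 0 < D' \<and> 0 \<le> q \<and> q < 1 \<and> (\<forall>k\<ge>1. norm (z k - x) \<le> D' * q ^ k)"
proof -
  define q where "q = B / (1 + B)"
  have q: "0 < q" "q < 1" using B by (simp_all add: q_def)
  have "\<forall>\<^sub>F k in sequentially. r (Suc k) < 1"
    using order_tendstoD(2)[OF LIMSEQ_Suc[OF r(2)] zero_less_one] .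
  with rec have "\<forall>\<^sub>F k in sequentially. r (Suc k) \<le> B * (r k - r (Suc k))"
  proof eventually_elim
    fix k assume le: "r (Suc k) powr (2 * \<omega>) \<le> B * (r k - r (Suc k))" and "r (Suc k) < 1"
    then have "r (Suc k) powr 1 \<le> r (Suc k) powr (2 * \<omega>)"
      using r(1) \<omega> by (intro powr_mono') auto
    with le show "r (Suc k) \<le> B * (r k - r (Suc k))" using r(1) by simp
  qed
  then obtain K where "\<And>k. K \<le> k \<Longrightarrow> r (Suc k) \<le> B * (r k - r (Suc k))"
    by (auto simp: eventually_sequentially)
  then have rate: "r k \<le> r K * q ^ (k - K)" if "K \<le> k" for k
    unfolding q_def using that B by (intro geometric_rate) auto
  \<comment> \<open>Dividing by \<open>sqrt q ^ Suc K\<close> undoes the shift in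
    \<open>q ^ (k - K)\<close> and produces the exponent \<open>Suc k\<close>.\<close>
  have "\<forall>\<^sub>F k in sequentially. norm (z (Suc k) - x)
      \<le> D * sqrt (r K) / sqrt q ^ Suc K * sqrt q ^ Suc k"
    using z eventually_ge_at_top[of K]
  proof eventually_elim
    fix k assume le: "norm (z (Suc k) - x) \<le> D * r k powr (1 / 2)" and k: "K \<le> k"
    have "r k powr (1 / 2) = sqrt (r k)" using r(1) by (simp add: powr_half_sqrt)
    also have "\<dots> \<le> sqrt (r K * q ^ (k - K))" using rate[OF k] by simp
    also have "\<dots> = sqrt (r K) * (sqrt q ^ Suc k / sqrt q ^ Suc K)"
      using k q by (simp add: real_sqrt_mult real_sqrt_power real_sqrt_divide power_diff)
    finally have "D * r k powr (1 / 2) \<le> D * (sqrt (r K) * (sqrt q ^ Suc k / sqrt q ^ Suc K))"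
      using D by (rule mult_left_mono)
    with le show "norm (z (Suc k) - x) \<le> D * sqrt (r K) / sqrt q ^ Suc K * sqrt q ^ Suc k"
      by (simp only: times_divide_eq_right times_divide_eq_left mult.assoc)
  qed
  then have "\<forall>\<^sub>F k in sequentially. norm (z k - x)
      \<le> D * sqrt (r K) / sqrt q ^ Suc K * sqrt q ^ k"
    by (subst (asm) eventually_sequentially_Suc)
  then have "\<exists>D'>0. \<forall>k\<ge>1. norm (z k - x) \<le> D' * sqrt q ^ k"
    by (rule eventually_le_imp_bound) (use q in simp)
  moreover have "0 \<le> sqrt q" "sqrt q < 1" using q by simp_all
  ultimately show ?thesis by blast
qed

text \<open>The choice \<beta> = 1/(2\<omega>-1) gives 1 + 1/\<beta> = 2\<omega>, so
  \<open>r\<close> decays like k^(-\<beta>); raising this to the power 1-\<omega> yields the stated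
  exponent.\<close>

lemma sublinear_convergence:
  fixes r :: "nat \<Rightarrow> real" and z :: "nat \<Rightarrow> 'a::real_normed_vector"
  assumes r: "\<And>k. 0 \<le> r k" and B: "0 < B" and D: "0 \<le> D"
    and rec: "\<forall>\<^sub>F k in sequentially. r (Suc k) powr (2 * \<omega>) \<le> B * (r k - r (Suc k))"
    and z: "\<forall>\<^sub>F k in sequentially. norm (z (Suc k) - x) \<le> D * r k powr (1 - \<omega>)"
    and \<omega>: "1 / 2 < \<omega>" "\<omega> < 1"
  shows "\<exists>D'>0. \<forall>k\<ge>1. norm (z k - x) \<le> D' * real k powr (- (1 - \<omega>) / (2 * \<omega> - 1))"
proof -
  define \<beta> where "\<beta> = 1 / (2 * \<omega> - 1)"
  have \<beta>: "0 < \<beta>" "1 + 1 / \<beta> = 2 * \<omega>" using \<omega> by (simp_all add: \<beta>_def)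
  from rec obtain K where "\<And>k. K \<le> k \<Longrightarrow> r (Suc k) powr (1 + 1 / \<beta>) \<le> B * (r k - r (Suc k))"
    unfolding \<beta>(2) by (auto simp: eventually_sequentially)
  then obtain d where d: "0 < d" and rate: "\<And>k. Suc K \<le> k \<Longrightarrow> r k \<le> d * real k powr (- \<beta>)"
    using sublinear_rate[of r B \<beta> K] r B \<beta>(1) by blast
  define \<gamma> where "\<gamma> = \<beta> * (1 - \<omega>)"
  have \<gamma>: "0 \<le> \<gamma>" "- (1 - \<omega>) / (2 * \<omega> - 1) = - \<gamma>"
    using \<omega> \<beta> by (simp_all add: \<gamma>_def \<beta>_def minus_divide_left)
  have "\<forall>\<^sub>F k in sequentially. norm (z (Suc k) - x)
      \<le> D * d powr (1 - \<omega>) * 2 powr \<gamma> * real (Suc k) powr (- \<gamma>)"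
    using z eventually_ge_at_top[of "Suc K"]
  proof eventually_elim
    fix k assume le: "norm (z (Suc k) - x) \<le> D * r k powr (1 - \<omega>)" and k: "Suc K \<le> k"
    have k0: "0 < real k" using k by simp
    have "r k powr (1 - \<omega>) \<le> (d * real k powr (- \<beta>)) powr (1 - \<omega>)"
      using rate[OF k] r \<omega> by (intro powr_mono2) auto
    also have "\<dots> = d powr (1 - \<omega>) * real k powr (- \<gamma>)"
      using d by (simp add: powr_mult powr_powr \<gamma>_def)
    \<comment> \<open>The factor \<open>2 powr \<gamma>\<close> pays for passing from index k to
      k+1, since k+1 \<le> 2k.\<close>
    also have "real k powr (- \<gamma>) = 2 powr \<gamma> * (2 * real k) powr (- \<gamma>)"
      using k0 by (simp add: powr_mult flip: powr_add mult.assoc)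
    also have "d powr (1 - \<omega>) * (2 powr \<gamma> * (2 * real k) powr (- \<gamma>))
        \<le> d powr (1 - \<omega>) * (2 powr \<gamma> * real (Suc k) powr (- \<gamma>))"
      using k \<gamma>(1) by (intro mult_left_mono powr_mono2') auto
    finally have "D * r k powr (1 - \<omega>)
        \<le> D * (d powr (1 - \<omega>) * (2 powr \<gamma> * real (Suc k) powr (- \<gamma>)))"
      using D by (rule mult_left_mono)
    with le show "norm (z (Suc k) - x)
        \<le> D * d powr (1 - \<omega>) * 2 powr \<gamma> * real (Suc k) powr (- \<gamma>)"
      by (simp only: mult.assoc)
  qed
  then have "\<forall>\<^sub>F k in sequentially. norm (z k - x)
      \<le> D * d powr (1 - \<omega>) * 2 powr \<gamma> * real k powr (- \<gamma>)"
    by (subst (asm) eventually_sequentially_Suc)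
  then have "\<exists>D'>0. \<forall>k\<ge>1. norm (z k - x) \<le> D' * real k powr (- \<gamma>)"
    by (rule eventually_le_imp_bound) simp
  then show ?thesis unfolding \<gamma>(2) .
qed

theorem theorem3:
  fixes \<Phi> :: "real ^ 'n \<Rightarrow> ereal"
    and A :: "real ^ 'n \<Rightarrow> (real ^ 'n) set"
    and z :: "nat \<Rightarrow> real ^ 'n"
    and \<zeta> :: "nat \<Rightarrow> real"
    and \<rho>1 \<rho>2 \<rho>3 \<omega> :: real
  assumes proper: "proper_fun \<Phi>"
    and lsc: "lower_semicontinuous \<Phi>"
    and bounded_below: "\<exists>m::real. \<forall>x. ereal m \<le> \<Phi> x"
    and algorithm: "\<And>k. z (Suc k) \<in> A (z k)"
    and bounded_seq: "bounded (range z)"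
    and rho_pos: "\<rho>1 > 0" "\<rho>2 > 0" "\<rho>3 > 0"
    and zeta_nonneg: "\<And>k. \<zeta> k \<ge> 0"
    and B1: "\<And>k. \<rho>1 * (norm (z k - z (Suc k)))\<^sup>2 \<le> \<rho>2 * (\<zeta> k)\<^sup>2 \<and>
                 ereal (\<rho>2 * (\<zeta> k)\<^sup>2) \<le> \<Phi> (z k) - \<Phi> (z (Suc k))"
    and B2: "\<exists>w. \<forall>k. w k \<in> limiting_subdiff \<Phi> (z k) \<and> norm (w (Suc k)) \<le> \<rho>3 * \<zeta> k"
    and B3: "KL_function \<Phi>"
    and B4: "\<And>r y. strict_mono r \<Longrightarrow> (\<lambda>n. z (r n)) \<longlonglongrightarrow> y \<Longrightarrow>
                 (\<lambda>n. \<Phi> (z (r n))) \<longlonglongrightarrow> \<Phi> y"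
    and omega: "0 \<le> \<omega>" "\<omega> < 1"
    and KL_form: "\<And>x. x \<in> dom_subdiff \<Phi> \<Longrightarrow>
                 \<exists>C>0. KL_property_with \<Phi> x (\<lambda>a. C * a powr (1 - \<omega>))"
  shows "\<exists>zbar. z \<longlonglongrightarrow> zbar \<and>
     (\<omega> = 0 \<longrightarrow> (\<exists>K. \<forall>k\<ge>K. z k = zbar)) \<and>
     (0 < \<omega> \<and> \<omega> \<le> 1/2 \<longrightarrow>
        (\<exists>\<omega>1 \<omega>2. \<omega>1 > 0 \<and> 0 \<le> \<omega>2 \<and> \<omega>2 < 1 \<and>
           (\<forall>k\<ge>1. norm (z k - zbar) \<le> \<omega>1 * \<omega>2 ^ k))) \<and>
     (1/2 < \<omega> \<and> \<omega> < 1 \<longrightarrow>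
        (\<exists>\<omega>1>0. \<forall>k\<ge>1. norm (z k - zbar) \<le> \<omega>1 * real k powr (- (1 - \<omega>) / (2 * \<omega> - 1))))"
proof -
  from bounded_below obtain m where m: "\<And>x. ereal m \<le> \<Phi> x" by blast
  from B2 obtain w where w: "\<And>k. w k \<in> limiting_subdiff \<Phi> (z k)"
      "\<And>k. norm (w (Suc k)) \<le> \<rho>3 * \<zeta> k" by blast
  obtain zbar r B D where z: "z \<longlonglongrightarrow> zbar" and r: "\<And>k. 0 \<le> r k" "r \<longlonglongrightarrow> 0"
    and BD: "0 < B" "0 \<le> D"
    and rec: "\<forall>\<^sub>F k in sequentially. r (Suc k) powr (2 * \<omega>) \<le> B * (r k - r (Suc k))"
    and zk: "\<forall>\<^sub>F k in sequentially.
      norm (z (Suc k) - zbar) \<le> D * r k powr (min (1 / 2) (1 - \<omega>))"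
  proof (rule KL_descent_convergence[where \<Phi> = \<Phi> and z = z and \<zeta> = \<zeta> and \<omega> = \<omega>,
        OF proper m bounded_seq rho_pos zeta_nonneg B1[THEN conjunct1] B1[THEN conjunct2] w _ omega])
    show "(\<lambda>n. \<Phi> (z (r n))) \<longlonglongrightarrow> \<Phi> y"
      if "strict_mono r" "(\<lambda>n. z (r n)) \<longlonglongrightarrow> y" for r y
      using B4[OF that] .
    show "\<exists>C>0. KL_property_with \<Phi> x (\<lambda>a. C * a powr (1 - \<omega>))" if "x \<in> dom_subdiff \<Phi>" for x
      using KL_form[OF that] .
  qed (rule that)
  show ?thesis
  proof (intro exI[of _ zbar] conjI impI)
    show "\<exists>K. \<forall>k\<ge>K. z k = zbar" if "\<omega> = 0"
      by (rule finite_convergence[OF r _ zk]) (use rec that in simp)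
    show "\<exists>\<omega>1 \<omega>2. 0 < \<omega>1 \<and> 0 \<le> \<omega>2 \<and> \<omega>2 < 1 \<and> (\<forall>k\<ge>1. norm (z k - zbar) \<le> \<omega>1 * \<omega>2 ^ k)"
      if \<omega>: "0 < \<omega> \<and> \<omega> \<le> 1 / 2"
    proof (rule linear_convergence[OF r BD rec])
      \<comment> \<open>In this range the bound on \<open>\<zeta>\<close> sets the exponent for the
        potential; for 1/2 < \<omega> the KL term does.\<close>
      have "min (1 / 2) (1 - \<omega>) = 1 / 2" using \<omega> by simp
      with zk show "\<forall>\<^sub>F k in sequentially. norm (z (Suc k) - zbar) \<le> D * r k powr (1 / 2)" by simp
    qed (use \<omega> in simp)
    show "\<exists>\<omega>1>0. \<forall>k\<ge>1. norm (z k - zbar) \<le> \<omega>1 * real k powr (- (1 - \<omega>) / (2 * \<omega> - 1))"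
      if \<omega>: "1 / 2 < \<omega> \<and> \<omega> < 1"
    proof (rule sublinear_convergence[OF r(1) BD rec])
      have "min (1 / 2) (1 - \<omega>) = 1 - \<omega>" using \<omega> by simp
      with zk show "\<forall>\<^sub>F k in sequentially. norm (z (Suc k) - zbar) \<le> D * r k powr (1 - \<omega>)" by simp
    qed (use \<omega> in simp_all)
  qed (fact z)
qed

end
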